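(* Let $(X,S_X)$, $(Y,S_Y)$ be finite nondegenerate symmetric sets, let $f:X\to X$ and $g:Y\to Y$ be permutations, and let $Z=X\sqcup Y$. Define $S_Z:Z\times Z\to Z\times Z$ to be $S_X$ on $X\times X$, $S_Y$ on $Y\times Y$, and $$S_Z(x,y)=(g(y),f(x)),\qquad S_Z(y,x)=(f^{-1}(x),g^{-1}(y))\qquad (x\in X,\ y\in Y).$$ Then these formulas define a union of $X$ and $Y$ (i.e. $(Z,S_Z)$ is a nondegenerate symmetric set) if and only if $f$ preserves $S_X$ and $g$ preserves $S_Y$, that is, $(f\times f)S_X=S_X(f\times f)$ and $(g\times g)S_Y=S_Y(g\times g)$.
   Context: For a nonempty set $X$ and a bijection $S:X\times X\to X\times X$, $S=(S_1,S_2)$: $(X,S)$ is nondegenerate if for all fixed $y,z\in X$ the maps $x\mapsto S_2(x,y)$ and $x\mapsto S_1(z,x)$ are bijections of $X$; braided if $S^{12}S^{23}S^{12}=S^{23}S^{12}S^{23}$ on $X^3$; involutive if $S^2=\mathrm{id}$; symmetric if braided and involutive. A nondegenerate symmetric set $(Z,S_Z)$ is a union of $(X,S_X)$ and $(Y,S_Y)$ if $Z=X\cup Y$, $X\cap Y=\emptyset$, and $S_Z$ restricts to $S_X$ on $X\times X$ and to $S_Y$ on $Y\times Y$. *)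

theory Defs imports Main begin

definition set_with_bijection :: "'a set \<Rightarrow> ('a \<times> 'a \<Rightarrow> 'a \<times> 'a) \<Rightarrow> bool" where
  "set_with_bijection X S \<longleftrightarrow> X \<noteq> {} \<and> bij_betw S (X \<times> X) (X \<times> X)"

definition nondegenerate :: "'a set \<Rightarrow> ('a \<times> 'a \<Rightarrow> 'a \<times> 'a) \<Rightarrow> bool" where
  "nondegenerate X S \<longleftrightarrow>
     (\<forall>y\<in>X. bij_betw (\<lambda>x. snd (S (x, y))) X X) \<and>
     (\<forall>z\<in>X. bij_betw (\<lambda>x. fst (S (z, x))) X X)"

definition act12 :: "('a \<times> 'a \<Rightarrow> 'a \<times> 'a) \<Rightarrow> 'a \<times> 'a \<times> 'a \<Rightarrow> 'a \<times> 'a \<times> 'a" where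
  "act12 S = (\<lambda>(x, y, z). (fst (S (x, y)), snd (S (x, y)), z))"

definition act23 :: "('a \<times> 'a \<Rightarrow> 'a \<times> 'a) \<Rightarrow> 'a \<times> 'a \<times> 'a \<Rightarrow> 'a \<times> 'a \<times> 'a" where
  "act23 S = (\<lambda>(x, y, z). (x, S (y, z)))"

definition braided :: "'a set \<Rightarrow> ('a \<times> 'a \<Rightarrow> 'a \<times> 'a) \<Rightarrow> bool" where
  "braided X S \<longleftrightarrow>
     (\<forall>t \<in> X \<times> X \<times> X. act12 S (act23 S (act12 S t)) = act23 S (act12 S (act23 S t)))"

definition involutive :: "'a set \<Rightarrow> ('a \<times> 'a \<Rightarrow> 'a \<times> 'a) \<Rightarrow> bool" where
  "involutive X S \<longleftrightarrow> (\<forall>p \<in> X \<times> X. S (S p) = p)"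

definition nondegenerate_symmetric_set :: "'a set \<Rightarrow> ('a \<times> 'a \<Rightarrow> 'a \<times> 'a) \<Rightarrow> bool" where
  "nondegenerate_symmetric_set X S \<longleftrightarrow>
     set_with_bijection X S \<and> nondegenerate X S \<and> braided X S \<and> involutive X S"

text \<open>The predicate \<open>is_union Z SZ i X SX j Y SY\<close> says that \<open>Z\<close> is a union of \<open>X\<close> and \<open>Y\<close>,
  where the inclusions of \<open>X\<close> and \<open>Y\<close> into \<open>Z\<close> are made explicit as injections \<open>i\<close> and \<open>j\<close>,
  since \<open>X\<close>, \<open>Y\<close> and \<open>Z\<close> may live in different types.\<close>

definition is_union ::
  "'c set \<Rightarrow> ('c \<times> 'c \<Rightarrow> 'c \<times> 'c) \<Rightarrow> ('a \<Rightarrow> 'c) \<Rightarrow> 'a set \<Rightarrow> ('a \<times> 'a \<Rightarrow> 'a \<times> 'a)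
    \<Rightarrow> ('b \<Rightarrow> 'c) \<Rightarrow> 'b set \<Rightarrow> ('b \<times> 'b \<Rightarrow> 'b \<times> 'b) \<Rightarrow> bool" where
  "is_union Z SZ i X SX j Y SY \<longleftrightarrow>
     nondegenerate_symmetric_set Z SZ \<and>
     inj_on i X \<and> inj_on j Y \<and> Z = i ` X \<union> j ` Y \<and> i ` X \<inter> j ` Y = {} \<and>
     (\<forall>p \<in> X \<times> X. SZ (map_prod i i p) = map_prod i i (SX p)) \<and>
     (\<forall>p \<in> Y \<times> Y. SZ (map_prod j j p) = map_prod j j (SY p))"

fun glued_map ::
  "'a set \<Rightarrow> ('a \<times> 'a \<Rightarrow> 'a \<times> 'a) \<Rightarrow> 'b set \<Rightarrow> ('b \<times> 'b \<Rightarrow> 'b \<times> 'b)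
    \<Rightarrow> ('a \<Rightarrow> 'a) \<Rightarrow> ('b \<Rightarrow> 'b) \<Rightarrow> ('a + 'b) \<times> ('a + 'b) \<Rightarrow> ('a + 'b) \<times> ('a + 'b)" where
  "glued_map X SX Y SY f g (Inl x, Inl x') = map_prod Inl Inl (SX (x, x'))"
| "glued_map X SX Y SY f g (Inr y, Inr y') = map_prod Inr Inr (SY (y, y'))"
| "glued_map X SX Y SY f g (Inl x, Inr y) = (Inr (g y), Inl (f x))"
| "glued_map X SX Y SY f g (Inr y, Inl x) = (Inl (inv_into X f x), Inr (inv_into Y g y))"

definition preserves :: "'a set \<Rightarrow> ('a \<Rightarrow> 'a) \<Rightarrow> ('a \<times> 'a \<Rightarrow> 'a \<times> 'a) \<Rightarrow> bool" where
  "preserves X f S \<longleftrightarrow> (\<forall>p \<in> X \<times> X. map_prod f f (S p) = S (map_prod f f p))"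

end

theory Submission imports Defs begin

text \<open>
  Bijectivity, involutivity and nondegeneracy of the glued map \<open>S\<^sub>Z\<close> hold for all permutations
  \<open>f\<close> and \<open>g\<close>. The pairs \<open>(x, y)\<close> and \<open>(y, x)\<close> with \<open>x \<in> X\<close>, \<open>y \<in> Y\<close> merely
  have their entries exchanged and moved, in one case by \<open>f\<close> and \<open>g\<close>, in the other by their
  inverses, and these two moves undo each other. Each of the maps \<open>z \<mapsto> snd (S\<^sub>Z (z, w))\<close> and
  \<open>z \<mapsto> fst (S\<^sub>Z (w, z))\<close> is a permutation of \<open>X\<close> together with a permutation of
  \<open>Y\<close>.

  All the content is in the braid relation (\<open>glued_braided_iff\<close>). On triples from \<open>X\<close> alone or
  from \<open>Y\<close> alone it is inherited. On a triple with entries \<open>x, x' \<in> X\<close> and one entry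
  \<open>y \<in> Y\<close>, the entry \<open>y\<close> is exchanged once with each of the other two, and the two sides
  differ in when \<open>S\<^sub>X\<close> is applied relative to these exchanges. For \<open>(x, x', y)\<close>, with
  \<open>S\<^sub>X (x, x') = (a, b)\<close>, the left-hand side is \<open>(g (g y), f a, f b)\<close> and the right-hand side
  is \<open>g (g y)\<close> followed by the two entries of \<open>S\<^sub>X (f x, f x')\<close>. Their equality says that
  \<open>f\<close> preserves \<open>S\<^sub>X\<close> (\<open>braid_at_XXY_iff\<close>), which gives necessity. The positions
  \<open>(x, y, x')\<close> and \<open>(y, x, x')\<close> give forms of the same condition that involve the inverse of
  \<open>f\<close> (\<open>braid_at_other_mixed\<close>), so the condition is also sufficient. Triples with two entries
  from \<open>Y\<close> lead likewise to \<open>g\<close> and \<open>S\<^sub>Y\<close>.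
\<close>

section \<open>Permutations that preserve a symmetric set\<close>

lemma nondegenerate_symmetric_set_closed:
  assumes "nondegenerate_symmetric_set X S" "x \<in> X" "x' \<in> X"
  shows "fst (S (x, x')) \<in> X" "snd (S (x, x')) \<in> X"
proof -
  have "S (x, x') \<in> X \<times> X"
    using assms bij_betwE[of S "X \<times> X" "X \<times> X"]
    unfolding nondegenerate_symmetric_set_def set_with_bijection_def by blast
  then show "fst (S (x, x')) \<in> X" "snd (S (x, x')) \<in> X"
    by (auto simp: mem_Times_iff)
qed

lemma permutation_inv_into:
  assumes "bij_betw f X X" "x \<in> X"
  shows "f x \<in> X" "inv_into X f x \<in> X" "f (inv_into X f x) = x" "inv_into X f (f x) = x"
  using assms(2) bij_betwE[OF assms(1)] bij_betwE[OF bij_betw_inv_into[OF assms(1)]]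
    bij_betw_inv_into_right[OF assms(1,2)] bij_betw_inv_into_left[OF assms(1,2)]
  by blast+

text \<open>The defining condition, with its inputs moved by \<open>f\<close> or its inverse in the ways that
  the braid relation on mixed triples produces: both entries are moved by \<open>f\<close> if the entry from
  the other set passes them in one direction, both by its inverse if it passes them in the other
  direction, and only one is moved before \<open>S\<close> is applied if it starts between them.\<close>

lemma preserves_permutation:
  assumes "preserves X f S" "bij_betw f X X" "nondegenerate_symmetric_set X S"
    and "x \<in> X" "x' \<in> X"
  shows "S (f x, f x') = map_prod f f (S (x, x'))"
    and "S (f x, x') = map_prod f f (S (x, inv_into X f x'))"
    and "S (x, f x') = map_prod f f (S (inv_into X f x, x'))"
    and "S (inv_into X f x, inv_into X f x')
      = map_prod (inv_into X f) (inv_into X f) (S (x, x'))"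
proof -
  note perm = permutation_inv_into[OF assms(2)]
  have pres: "S (f u, f v) = map_prod f f (S (u, v))" if "u \<in> X" "v \<in> X" for u v
    using assms(1) that by (auto simp: preserves_def)
  show "S (f x, f x') = map_prod f f (S (x, x'))"
    using pres assms(4,5) .
  show "S (f x, x') = map_prod f f (S (x, inv_into X f x'))"
    using pres[of x "inv_into X f x'"] assms(4,5) by (simp add: perm)
  show "S (x, f x') = map_prod f f (S (inv_into X f x, x'))"
    using pres[of "inv_into X f x" x'] assms(4,5) by (simp add: perm)
  define u where "u = inv_into X f x"
  define v where "v = inv_into X f x'"
  have uv: "u \<in> X" "v \<in> X" "x = f u" "x' = f v"
    using assms(4,5) by (simp_all add: u_def v_def perm)
  note closed = nondegenerate_symmetric_set_closed[OF assms(3) uv(1,2)]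
  have "map_prod (inv_into X f) (inv_into X f) (S (x, x')) = S (u, v)"
    using pres[OF uv(1,2)] uv closed by (cases "S (u, v)") (simp add: perm)
  then show "S (inv_into X f x, inv_into X f x')
      = map_prod (inv_into X f) (inv_into X f) (S (x, x'))"
    by (simp add: u_def v_def)
qed

section \<open>Properties of the glued map that hold for all permutations\<close>

lemma bij_betw_Plus:
  assumes "bij_betw p A A'" "bij_betw q B B'"
    and "\<And>a. a \<in> A \<Longrightarrow> h (Inl a) = Inl (p a)" "\<And>b. b \<in> B \<Longrightarrow> h (Inr b) = Inr (q b)"
  shows "bij_betw h (A <+> B) (A' <+> B')"
proof -
  have "h ` Inl ` A = Inl ` p ` A" "h ` Inr ` B = Inr ` q ` B"
    unfolding image_image using assms(3,4) by (auto intro!: image_cong)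
  then have "h ` (A <+> B) = A' <+> B'"
    using assms(1,2) by (simp add: Plus_def image_Un bij_betw_imp_surj_on)
  moreover have "inj_on h (A <+> B)"
  proof (rule inj_onI)
    fix u v assume "u \<in> A <+> B" "v \<in> A <+> B" "h u = h v"
    then show "u = v"
      using bij_betw_imp_inj_on[OF assms(1)] bij_betw_imp_inj_on[OF assms(2)]
      by (elim PlusE) (simp_all add: assms(3,4) inj_on_eq_iff)
  qed
  ultimately show ?thesis
    by (simp add: bij_betw_def)
qed

locale gluing =
  fixes X :: "'a set" and SX :: "'a \<times> 'a \<Rightarrow> 'a \<times> 'a"
    and Y :: "'b set" and SY :: "'b \<times> 'b \<Rightarrow> 'b \<times> 'b"
    and f :: "'a \<Rightarrow> 'a" and g :: "'b \<Rightarrow> 'b"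
  assumes symX: "nondegenerate_symmetric_set X SX"
    and symY: "nondegenerate_symmetric_set Y SY"
    and permf: "bij_betw f X X"
    and permg: "bij_betw g Y Y"
begin

abbreviation "Z \<equiv> X <+> Y"
abbreviation "SZ \<equiv> glued_map X SX Y SY f g"

lemmas closed =
  nondegenerate_symmetric_set_closed[OF symX] nondegenerate_symmetric_set_closed[OF symY]
lemmas perm = permutation_inv_into[OF permf] permutation_inv_into[OF permg]

lemma glued_components:
  "SZ (Inl x, Inl x') = (Inl (fst (SX (x, x'))), Inl (snd (SX (x, x'))))"
  "SZ (Inr y, Inr y') = (Inr (fst (SY (y, y'))), Inr (snd (SY (y, y'))))"
  by (simp_all add: map_prod_def split_beta)

text \<open>In the iterates of \<open>SZ\<close>, a value must be an explicit pair of injections before the defining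
  equations apply to it again.\<close>

declare glued_map.simps(1,2) [simp del] glued_components [simp]

lemma glued_closed: "p \<in> Z \<times> Z \<Longrightarrow> SZ p \<in> Z \<times> Z"
  by (auto simp: perm closed)

lemma glued_involutive: "involutive Z SZ"
  using symX symY
  by (auto simp: nondegenerate_symmetric_set_def involutive_def perm)

lemma glued_bijection: "set_with_bijection Z SZ"
  unfolding set_with_bijection_def
proof
  show "Z \<noteq> {}"
    using symX by (auto simp: nondegenerate_symmetric_set_def set_with_bijection_def)
  have "\<forall>p\<in>Z \<times> Z. SZ (SZ p) = p"
    using glued_involutive by (simp only: involutive_def)
  moreover have "SZ ` (Z \<times> Z) \<subseteq> Z \<times> Z"
    using glued_closed by (rule image_subsetI)
  ultimately show "bij_betw SZ (Z \<times> Z) (Z \<times> Z)"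
    by (intro bij_betw_byWitness)
qed

lemma glued_nondegenerate: "nondegenerate Z SZ"
proof -
  have "bij_betw (\<lambda>z. snd (SZ (z, w))) Z Z" if "w \<in> Z" for w
    using that
  proof
    fix x assume "x \<in> X" "w = Inl x"
    then show ?thesis
      using symX bij_betw_inv_into[OF permg]
      by (intro bij_betw_Plus[of "\<lambda>x'. snd (SX (x', x))" _ _ "inv_into Y g"])
        (auto simp: nondegenerate_symmetric_set_def nondegenerate_def)
  next
    fix y assume "y \<in> Y" "w = Inr y"
    then show ?thesis
      using symY permf
      by (intro bij_betw_Plus[of f _ _ "\<lambda>y'. snd (SY (y', y))"])
        (auto simp: nondegenerate_symmetric_set_def nondegenerate_def)
  qed
  moreover have "bij_betw (\<lambda>z. fst (SZ (w, z))) Z Z" if "w \<in> Z" for w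
    using that
  proof
    fix x assume "x \<in> X" "w = Inl x"
    then show ?thesis
      using symX permg
      by (intro bij_betw_Plus[of "\<lambda>x'. fst (SX (x, x'))" _ _ g])
        (auto simp: nondegenerate_symmetric_set_def nondegenerate_def)
  next
    fix y assume "y \<in> Y" "w = Inr y"
    then show ?thesis
      using symY bij_betw_inv_into[OF permf]
      by (intro bij_betw_Plus[of "inv_into X f" _ _ "\<lambda>y'. fst (SY (y, y'))"])
        (auto simp: nondegenerate_symmetric_set_def nondegenerate_def)
  qed
  ultimately show ?thesis
    by (simp add: nondegenerate_def)
qed

section \<open>The braid relation for the glued map\<close>

abbreviation "braid_at S t \<equiv> act12 S (act23 S (act12 S t)) = act23 S (act12 S (act23 S t))"

lemma braid_at_pure:
  "braid_at SX (x, x', x'') \<Longrightarrow> braid_at SZ (Inl x, Inl x', Inl x'')"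
  "braid_at SY (y, y', y'') \<Longrightarrow> braid_at SZ (Inr y, Inr y', Inr y'')"
  by (auto simp: act12_def act23_def split_beta prod_eq_iff)

text \<open>When the entries from \<open>X\<close> stand to the left of those from \<open>Y\<close>, every mixed exchange
  is of the form \<open>(x, y) \<mapsto> (g y, f x)\<close>, so no inverses occur and the braid relation is the
  preservation condition itself.\<close>

lemma braid_at_XXY_iff:
  "braid_at SZ (Inl x, Inl x', Inr y) \<longleftrightarrow> map_prod f f (SX (x, x')) = SX (f x, f x')"
  by (auto simp: act12_def act23_def prod_eq_iff)

lemma braid_at_XYY_iff:
  "braid_at SZ (Inl x, Inr y, Inr y') \<longleftrightarrow> map_prod g g (SY (y, y')) = SY (g y, g y')"
  by (auto simp: act12_def act23_def prod_eq_iff)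

lemma braid_at_other_mixed:
  assumes "preserves X f SX" "preserves Y g SY" "x \<in> X" "x' \<in> X" "y \<in> Y" "y' \<in> Y"
  shows "braid_at SZ (Inl x, Inr y, Inl x')" "braid_at SZ (Inr y, Inl x, Inl x')"
    and "braid_at SZ (Inr y, Inl x, Inr y')" "braid_at SZ (Inr y, Inr y', Inl x)"
proof -
  note presX = preserves_permutation[OF assms(1) permf symX]
  note presY = preserves_permutation[OF assms(2) permg symY]
  show "braid_at SZ (Inl x, Inr y, Inl x')"
    using presX(2)[OF assms(3,4)] assms(3-) by (simp add: act12_def act23_def perm closed)
  show "braid_at SZ (Inr y, Inl x, Inl x')"
    using presX(4)[OF assms(3,4)] assms(3-) by (simp add: act12_def act23_def perm closed)
  show "braid_at SZ (Inr y, Inl x, Inr y')"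
    using presY(3)[OF assms(5,6)] assms(3-) by (simp add: act12_def act23_def perm closed)
  show "braid_at SZ (Inr y, Inr y', Inl x)"
    using presY(4)[OF assms(5,6)] assms(3-) by (simp add: act12_def act23_def perm closed)
qed

lemma glued_braided_iff: "braided Z SZ \<longleftrightarrow> preserves X f SX \<and> preserves Y g SY"
proof
  assume braid: "braided Z SZ"
  \<comment> \<open>Each condition is read off from triples with an arbitrary entry of the other set, so both sets
    must be nonempty.\<close>
  obtain x\<^sub>0 y\<^sub>0 where "x\<^sub>0 \<in> X" "y\<^sub>0 \<in> Y"
    using symX symY by (auto simp: nondegenerate_symmetric_set_def set_with_bijection_def)
  have "map_prod f f (SX (x, x')) = SX (f x, f x')" if "x \<in> X" "x' \<in> X" for x x'
    using braid that \<open>y\<^sub>0 \<in> Y\<close> unfolding braid_at_XXY_iff[of x x' y\<^sub>0, symmetric]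
    by (simp only: braided_def) blast
  moreover
  have "map_prod g g (SY (y, y')) = SY (g y, g y')" if "y \<in> Y" "y' \<in> Y" for y y'
    using braid that \<open>x\<^sub>0 \<in> X\<close> unfolding braid_at_XYY_iff[of x\<^sub>0 y y', symmetric]
    by (simp only: braided_def) blast
  ultimately show "preserves X f SX \<and> preserves Y g SY"
    by (auto simp: preserves_def)
next
  assume pres: "preserves X f SX \<and> preserves Y g SY"
  have braidX: "braid_at SX t" if "t \<in> X \<times> X \<times> X" for t
    using symX that by (simp only: nondegenerate_symmetric_set_def braided_def)
  have braidY: "braid_at SY t" if "t \<in> Y \<times> Y \<times> Y" for t
    using symY that by (simp only: nondegenerate_symmetric_set_def braided_def)
  have "braid_at SZ (a, b, c)" if "a \<in> Z" "b \<in> Z" "c \<in> Z" for a b c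
  proof -
    have "map_prod f f (SX (x, x')) = SX (f x, f x')" if "x \<in> X" "x' \<in> X" for x x'
      using pres that by (auto simp: preserves_def)
    moreover have "map_prod g g (SY (y, y')) = SY (g y, g y')" if "y \<in> Y" "y' \<in> Y" for y y'
      using pres that by (auto simp: preserves_def)
    ultimately show ?thesis
      using that pres
      by (elim PlusE; hypsubst;
          intro braid_at_pure braidX braidY braid_at_other_mixed
            braid_at_XXY_iff[THEN iffD2] braid_at_XYY_iff[THEN iffD2]; blast)
  qed
  then show "braided Z SZ"
    unfolding braided_def by blast
qed

end

theorem proposition3p9:
  fixes X :: "'a set" and SX :: "'a \<times> 'a \<Rightarrow> 'a \<times> 'a"
    and Y :: "'b set" and SY :: "'b \<times> 'b \<Rightarrow> 'b \<times> 'b"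
    and f :: "'a \<Rightarrow> 'a" and g :: "'b \<Rightarrow> 'b"
  assumes "finite X" and "nondegenerate_symmetric_set X SX"
    and "finite Y" and "nondegenerate_symmetric_set Y SY"
    and "bij_betw f X X" and "bij_betw g Y Y"
  shows "is_union (X <+> Y) (glued_map X SX Y SY f g) Inl X SX Inr Y SY
    \<longleftrightarrow> preserves X f SX \<and> preserves Y g SY"
proof -
  interpret gluing X SX Y SY f g
    using assms by unfold_locales
  have "is_union Z SZ Inl X SX Inr Y SY \<longleftrightarrow> nondegenerate_symmetric_set Z SZ"
    by (auto simp: is_union_def Plus_def prod_eq_iff)
  also have "\<dots> \<longleftrightarrow> braided Z SZ"
    using glued_bijection glued_nondegenerate glued_involutive
    by (simp add: nondegenerate_symmetric_set_def)
  finally show ?thesis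
    by (simp only: glued_braided_iff)
qed

end
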